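(* For any $n$, the local queue number of the complete graph $K_n$ on $n$ vertices satisfies $$\operatorname{qn}_\ell(K_n) > \Bigl(1-\frac{1}{\sqrt{2}}\Bigr)n - \frac{1}{16}\bigl(9-4\sqrt{2}\bigr).$$
   Context: For a fixed total ordering $\prec$ of the vertices of a graph $G$, two independent edges (edges with no common endpoint) $vw$ and $xy$ with $v \prec w$ and $x \prec y$ nest if $v \prec x \prec y \prec w$ or $x \prec v \prec w \prec y$. A queue (with respect to $\prec$) is a set of edges that are pairwise non-nesting. A queue layout of $G$ consists of a vertex ordering $\prec$ and a partition of $E(G)$ into queues; it is $k$-local if each vertex has incident edges in at most $k$ of the queues. The local queue number $\operatorname{qn}_\ell(G)$ is the smallest $k$ such that $G$ has a $k$-local queue layout (the total number of queues is unrestricted).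
   Formalization: The case n = 1 is excluded: K_1 has no edges, so its local queue number is 0, while the right-hand side is about 0.084, so the claimed strict inequality fails there. *)

theory Defs
  imports Complex_Main "HOL-Library.Disjoint_Sets" "HOL-Library.Ramsey"
begin

text \<open>A finite simple graph is given by its vertex set \<open>V\<close> and its edge set
  \<open>E\<close>, a set of two-element subsets of \<open>V\<close>. A vertex ordering is a strict linear order
  on \<open>V\<close>, as a relation \<open>r\<close>.\<close>

abbreviation complete_graph_edges :: "'a set \<Rightarrow> 'a set set" where
  "complete_graph_edges V \<equiv> nsets V 2"

definition nest :: "'a rel \<Rightarrow> 'a set \<Rightarrow> 'a set \<Rightarrow> bool" where
  "nest r e f \<longleftrightarrow> e \<inter> f = {} \<and>
     (\<exists>v w x y. e = {v, w} \<and> f = {x, y} \<and> (v, w) \<in> r \<and> (x, y) \<in> r \<and>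
        ((v, x) \<in> r \<and> (x, y) \<in> r \<and> (y, w) \<in> r \<or>
         (x, v) \<in> r \<and> (v, w) \<in> r \<and> (w, y) \<in> r))"

definition queue :: "'a rel \<Rightarrow> 'a set set \<Rightarrow> bool" where
  "queue r Q \<longleftrightarrow> pairwise (\<lambda>e f. \<not> nest r e f) Q"

definition queue_layout :: "'a set \<Rightarrow> 'a set set \<Rightarrow> 'a rel \<Rightarrow> 'a set set set \<Rightarrow> bool" where
  "queue_layout V E r \<Q> \<longleftrightarrow>
     strict_linear_order_on V r \<and> partition_on E \<Q> \<and> (\<forall>Q\<in>\<Q>. queue r Q)"

text \<open>Finiteness is stated because the cardinality of an infinite set is \<open>0\<close>.\<close>

definition k_local :: "nat \<Rightarrow> 'a set \<Rightarrow> 'a set set set \<Rightarrow> bool" where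
  "k_local k V \<Q> \<longleftrightarrow>
     (\<forall>v\<in>V. finite {Q \<in> \<Q>. \<exists>e\<in>Q. v \<in> e} \<and> card {Q \<in> \<Q>. \<exists>e\<in>Q. v \<in> e} \<le> k)"

definition local_queue_number :: "'a set \<Rightarrow> 'a set set \<Rightarrow> nat" where
  "local_queue_number V E = (LEAST k. \<exists>r \<Q>. queue_layout V E r \<Q> \<and> k_local k V \<Q>)"

text \<open>For finite graphs the minimum is taken over a nonempty set: every edge may form
  a queue of its own.\<close>

lemma k_local_queue_layout_exists:
  assumes "finite V" and "E \<subseteq> nsets V 2"
  shows "\<exists>k r \<Q>. queue_layout V E r \<Q> \<and> k_local k V \<Q>"
proof -
  obtain f :: "'a \<Rightarrow> nat" where f: "inj_on f V"
    using finite_imp_inj_to_nat_seg[OF assms(1)] by blast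
  define r where "r = {(x, y). f x < f y}"
  define \<Q> where "\<Q> = (\<lambda>e. {e}) ` E"
  have "finite E"
    using assms by (meson finite_imp_finite_nsets finite_subset)
  then have fin: "finite \<Q>" by (simp add: \<Q>_def)
  have "strict_linear_order_on V r"
    unfolding strict_linear_order_on_def r_def
    using f by (auto simp: trans_def irrefl_def total_on_def inj_on_def) (metis nat_neq_iff)
  moreover have "partition_on E \<Q>"
    by (auto simp: \<Q>_def partition_on_def disjoint_def)
  moreover have "\<forall>Q\<in>\<Q>. queue r Q"
    by (auto simp: \<Q>_def queue_def)
  moreover have "k_local (card \<Q>) V \<Q>"
    using fin by (auto simp: k_local_def intro!: card_mono)
  ultimately show ?thesis
    unfolding queue_layout_def by blast
qed

lemma local_queue_number_attained:
  assumes "finite V" and "E \<subseteq> nsets V 2"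
  shows "\<exists>r \<Q>. queue_layout V E r \<Q> \<and> k_local (local_queue_number V E) V \<Q>"
  unfolding local_queue_number_def
  using LeastI_ex[OF k_local_queue_layout_exists[OF assms]] .

end

theory Submission
  imports Defs
begin

text \<open>
  The bound comes from double counting. Write the edges of a queue as pairs (left endpoint, right
  endpoint). Non-nesting means that these pairs form a chain in the product order, so a queue has
  at most as many edges as it has left endpoints plus right endpoints
  (\<open>card_queue_le_endpoints\<close>). Counting every vertex of the queue twice, once on each side,
  would only yield about \<open>n / 4\<close>. The gain comes from discarding the edges inside the set
  \<open>L\<close> of the first \<open>a\<close> vertices and inside the set \<open>R\<close> of the last \<open>a\<close> vertices: among the
  remaining edges no vertex of \<open>R\<close> is a left endpoint and no vertex of \<open>L\<close> is a right endpoint.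
  A \<open>k\<close>-local layout lets each vertex occur in at most \<open>k\<close> queues, so summing over all
  queues shows that the remaining \<open>n (n - 1) / 2 - a (a - 1)\<close> edges number at most
  \<open>2 k (n - a)\<close> (\<open>k_local_complete_bound\<close>).

  The ratio \<open>(1/2 - \<alpha>\<^sup>2) / (2 (1 - \<alpha>))\<close>, to which this leads for \<open>a = \<alpha> n\<close>, is
  largest at \<open>\<alpha> = 1 - 1 / sqrt 2\<close>, where its value is again \<open>\<alpha>\<close>. The additive constant pays for
  rounding \<open>a\<close> to an integer (\<open>threshold_from_trimming\<close>).
\<close>

section \<open>The size of a queue\<close>

definition left_ends :: "'a rel \<Rightarrow> 'a set set \<Rightarrow> 'a set" where
  "left_ends r S = {x. \<exists>y. (x, y) \<in> r \<and> {x, y} \<in> S}"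

definition right_ends :: "'a rel \<Rightarrow> 'a set set \<Rightarrow> 'a set" where
  "right_ends r S = {y. \<exists>x. (x, y) \<in> r \<and> {x, y} \<in> S}"

lemma edge_oriented:
  assumes "strict_linear_order_on V r" and "e \<in> nsets V 2"
  obtains x y where "e = {x, y}" "(x, y) \<in> r" "x \<in> V" "y \<in> V"
proof -
  obtain x y where xy: "e = {x, y}" "x \<noteq> y" "x \<in> V" "y \<in> V"
    using assms(2) by (auto simp: nsets_def card_2_iff)
  then have "(x, y) \<in> r \<or> (y, x) \<in> r"
    using assms(1) by (auto simp: strict_linear_order_on_def total_on_def)
  then show thesis
    using xy that[of x y] that[of y x] by (auto simp: insert_commute)
qed

text \<open>Charge an edge to its left endpoint if it is the shortest edge of the queue starting there,
  and to its right endpoint otherwise. If \<open>xy\<close> and \<open>x'y\<close> with \<open>x \<prec> x'\<close> were both charged to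
  \<open>y\<close>, then a shorter edge \<open>x'z\<close> would nest inside \<open>xy\<close>; so no endpoint is charged twice
  on the same side.\<close>

lemma card_queue_le_endpoints:
  assumes lin: "strict_linear_order_on V r" and "finite V"
    and S: "S \<subseteq> nsets V 2" and "queue r S"
  shows "card S \<le> card (left_ends r S) + card (right_ends r S)"
proof -
  have tr: "(x, z) \<in> r" if "(x, y) \<in> r" "(y, z) \<in> r" for x y z
    using lin that by (auto simp: strict_linear_order_on_def dest: transD)
  have ir: "(x, x) \<notin> r" for x
    using lin by (auto simp: strict_linear_order_on_def irrefl_def)
  have tot: "(x, y) \<in> r \<or> (y, x) \<in> r \<or> x = y" if "x \<in> V" "y \<in> V" for x y
    using lin that by (auto simp: strict_linear_order_on_def total_on_def)
  have inV: "x \<in> V" "y \<in> V" if "{x, y} \<in> S" for x y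
    using S that by (auto simp: nsets_def)
  define P where "P = {(x, y). (x, y) \<in> r \<and> {x, y} \<in> S}"
  define F where "F = {(x, y) \<in> P. \<forall>z. (x, z) \<in> P \<longrightarrow> (z, y) \<notin> r}"
  have finP: "finite P"
    by (rule finite_subset[of _ "V \<times> V"]) (use inV \<open>finite V\<close> in \<open>auto simp: P_def\<close>)
  have FP: "F \<subseteq> P" by (auto simp: F_def)
  have SP: "S \<subseteq> (\<lambda>(x, y). {x, y}) ` P"
  proof
    fix e assume "e \<in> S"
    with S obtain x y where "e = {x, y}" "(x, y) \<in> r"
      by (meson edge_oriented lin subsetD)
    with \<open>e \<in> S\<close> show "e \<in> (\<lambda>(x, y). {x, y}) ` P"
      by (force simp: P_def)
  qed
  have nonest: False
    if "(x, y) \<in> P" "(x', z) \<in> P" "(x, x') \<in> r" "(z, y) \<in> r" for x y x' z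
  proof -
    have rel: "(x', z) \<in> r" "(x, y) \<in> r" "{x, y} \<in> S" "{x', z} \<in> S"
      using that by (auto simp: P_def)
    have disj: "{x, y} \<inter> {x', z} = {}"
      using that(3,4) rel tr ir by blast
    then have "nest r {x, y} {x', z}"
      unfolding nest_def using that(3,4) rel by blast
    moreover have "{x, y} \<noteq> {x', z}" using disj by blast
    ultimately show False
      using \<open>queue r S\<close> rel by (auto simp: queue_def pairwise_def)
  qed
  have "inj_on fst F"
  proof (rule inj_onI)
    fix p q assume pq: "p \<in> F" "q \<in> F" "fst p = fst q"
    obtain x y y' where eq: "p = (x, y)" "q = (x, y')"
      using pq(3) by (metis prod.collapse)
    have "(x, y) \<in> P" "(x, y') \<in> P" "(y', y) \<notin> r" "(y, y') \<notin> r"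
      using pq eq by (auto simp: F_def)
    moreover from this have "y \<in> V" "y' \<in> V"
      using inV by (auto simp: P_def)
    ultimately show "p = q" using tot eq by blast
  qed
  moreover have "fst ` F \<subseteq> left_ends r S"
    by (auto simp: F_def P_def left_ends_def)
  moreover have fin: "finite (left_ends r S)" "finite (right_ends r S)"
    by (rule finite_subset[OF _ \<open>finite V\<close>],
        use inV in \<open>auto simp: left_ends_def right_ends_def\<close>)+
  ultimately have cF: "card F \<le> card (left_ends r S)"
    by (metis card_inj_on_le)
  have clash: False
    if xy: "(x, y) \<in> P - F" "(x', y) \<in> P - F" "(x, x') \<in> r" for x x' y
  proof -
    obtain z where "(x', z) \<in> P" "(z, y) \<in> r"
      using xy(2) by (auto simp: F_def)
    with nonest[of x y x' z] xy show False by blast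
  qed
  have "inj_on snd (P - F)"
  proof (rule inj_onI)
    fix p q assume pq: "p \<in> P - F" "q \<in> P - F" "snd p = snd q"
    obtain x x' y where eq: "p = (x, y)" "q = (x', y)"
      using pq(3) by (metis prod.collapse)
    have "(x, x') \<notin> r" "(x', x) \<notin> r"
      using clash pq(1,2) unfolding eq by blast+
    moreover have "x \<in> V" "x' \<in> V"
      using pq(1,2) inV unfolding eq P_def by auto
    ultimately show "p = q" using tot eq by blast
  qed
  moreover have "snd ` (P - F) \<subseteq> right_ends r S"
    by (auto simp: P_def right_ends_def)
  ultimately have cG: "card (P - F) \<le> card (right_ends r S)"
    using fin by (metis card_inj_on_le)
  have "card S \<le> card P"
    using SP finP by (rule surj_card_le[rotated])
  also have "\<dots> = card F + card (P - F)"
    using finP FP by (metis card_Diff_subset card_mono finite_subset le_add_diff_inverse)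
  finally show ?thesis using cF cG by linarith
qed

section \<open>Counting the edges that survive trimming\<close>

lemma k_local_incidences_le:
  assumes "finite V" and "finite \<Q>" and "k_local k V \<Q>" and "W \<subseteq> V"
  shows "(\<Sum>Q\<in>\<Q>. card (\<Union>Q \<inter> W)) \<le> k * card W"
proof -
  have finW: "finite W" using assms finite_subset by blast
  have "(\<Sum>Q\<in>\<Q>. card (\<Union>Q \<inter> W)) = (\<Sum>Q\<in>\<Q>. card {v \<in> W. v \<in> \<Union>Q})"
    by (rule sum.cong) (auto intro: arg_cong[where f = card])
  also have "\<dots> = (\<Sum>v\<in>W. card {Q \<in> \<Q>. v \<in> \<Union>Q})"
    using sum_multicount_gen[OF assms(2) finW, of "\<lambda>Q v. v \<in> \<Union>Q"
        "\<lambda>v. card {Q \<in> \<Q>. v \<in> \<Union>Q}"] by simp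
  also have "\<dots> \<le> (\<Sum>v\<in>W. k)"
  proof (rule sum_mono)
    fix v assume "v \<in> W"
    with assms(3,4) show "card {Q \<in> \<Q>. v \<in> \<Union>Q} \<le> k"
      by (auto simp: k_local_def Bex_def)
  qed
  finally show ?thesis by (simp add: mult.commute)
qed

lemma strict_linear_order_rank:
  assumes lin: "strict_linear_order_on V r" and fin: "finite V"
  obtains f where "bij_betw f V {..<card V}"
    and "\<And>x y. x \<in> V \<Longrightarrow> y \<in> V \<Longrightarrow> (x, y) \<in> r \<Longrightarrow> f x < (f y :: nat)"
proof -
  define f where "f x = card {z \<in> V. (z, x) \<in> r}" for x
  have ir: "(x, x) \<notin> r" for x
    using lin by (auto simp: strict_linear_order_on_def irrefl_def)
  have mono: "f x < f y" if "x \<in> V" "y \<in> V" "(x, y) \<in> r" for x y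
    unfolding f_def
  proof (rule psubset_card_mono)
    show "finite {z \<in> V. (z, y) \<in> r}" using fin by simp
    have "{z \<in> V. (z, x) \<in> r} \<subseteq> {z \<in> V. (z, y) \<in> r}"
      using lin that(3) by (auto simp: strict_linear_order_on_def dest: transD)
    then show "{z \<in> V. (z, x) \<in> r} \<subset> {z \<in> V. (z, y) \<in> r}"
      using that ir by blast
  qed
  have inj: "inj_on f V"
  proof (rule inj_onI)
    fix x y assume xy: "x \<in> V" "y \<in> V" "f x = f y"
    then show "x = y"
      using lin mono[of x y] mono[of y x]
      by (auto simp: strict_linear_order_on_def total_on_def)
  qed
  have "f ` V \<subseteq> {..<card V}"
  proof
    fix i assume "i \<in> f ` V"
    then obtain x where x: "x \<in> V" "i = f x" by blast
    have "{z \<in> V. (z, x) \<in> r} \<subset> V" using x ir by blast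
    then show "i \<in> {..<card V}"
      using psubset_card_mono[OF fin] x by (auto simp: f_def)
  qed
  moreover have "card (f ` V) = card V" by (rule card_image[OF inj])
  ultimately have "f ` V = {..<card V}"
    by (metis card_lessThan card_subset_eq finite_lessThan)
  with inj have "bij_betw f V {..<card V}" by (simp add: bij_betw_def)
  with mono show thesis using that by blast
qed

text \<open>Trimming \<open>a\<close> vertices on either side: the vertices outside \<open>R\<close> account for all left
  endpoints and those outside \<open>L\<close> for all right endpoints of the edges that are kept.\<close>

lemma k_local_complete_bound:
  assumes fin: "finite V" and lay: "queue_layout V (nsets V 2) r \<Q>"
    and loc: "k_local k V \<Q>" and a: "2 * a \<le> card V"
  shows "card V choose 2 \<le> 2 * k * (card V - a) + 2 * (a choose 2)"
proof -
  define n where "n = card V"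
  have lin: "strict_linear_order_on V r" and part: "partition_on (nsets V 2) \<Q>"
    and que: "\<And>Q. Q \<in> \<Q> \<Longrightarrow> queue r Q"
    using lay by (auto simp: queue_layout_def)
  obtain f where f: "bij_betw f V {..<n}"
    and mono: "\<And>x y. x \<in> V \<Longrightarrow> y \<in> V \<Longrightarrow> (x, y) \<in> r \<Longrightarrow> f x < (f y :: nat)"
    using strict_linear_order_rank[OF lin fin] unfolding n_def by blast
  have preimage_card: "card {x \<in> V. f x \<in> I} = card I" if "I \<subseteq> {..<n}" for I
  proof -
    have "f ` {x \<in> V. f x \<in> I} = I"
      using f that by (auto simp: bij_betw_def)
    moreover have "inj_on f {x \<in> V. f x \<in> I}"
      by (rule inj_on_subset[of _ V]) (use f in \<open>auto simp: bij_betw_def\<close>)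
    ultimately show ?thesis by (metis card_image)
  qed
  define L where "L = {x \<in> V. f x \<in> {..<a}}"
  define R where "R = {x \<in> V. f x \<in> {n - a..<n}}"
  have LV: "L \<subseteq> V" and RV: "R \<subseteq> V" by (auto simp: L_def R_def)
  have cL: "card L = a" unfolding L_def
    using a by (subst preimage_card) (auto simp: n_def)
  have cR: "card R = a" unfolding R_def
    using a by (subst preimage_card) (auto simp: n_def)
  have finLR: "finite L" "finite R" using LV RV fin finite_subset by blast+
  define E where "E = nsets V 2 - (nsets L 2 \<union> nsets R 2)"
  have finE: "finite (nsets V 2)" using fin by (rule finite_imp_finite_nsets)
  have part_union: "\<Union>\<Q> = nsets V 2" using part by (simp add: partition_on_def)
  have finQ: "finite \<Q>"
    using part_union finE by (metis finite_UnionD)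
  have "card V choose 2 = card (nsets V 2)" by simp
  also have "\<dots> \<le> card (E \<union> (nsets L 2 \<union> nsets R 2))"
    by (rule card_mono) (use finE finLR in \<open>auto simp: E_def finite_imp_finite_nsets\<close>)
  also have "\<dots> \<le> card E + (card (nsets L 2) + card (nsets R 2))"
    by (meson card_Un_le le_trans add_left_mono)
  also have "\<dots> = card E + 2 * (a choose 2)"
    using cL cR by simp
  finally have edges: "card V choose 2 \<le> card E + 2 * (a choose 2)" .
  have left_notR: "left_ends r (Q \<inter> E) \<subseteq> \<Union>Q \<inter> (V - R)" for Q
  proof
    fix x assume "x \<in> left_ends r (Q \<inter> E)"
    then obtain y where y: "(x, y) \<in> r" "{x, y} \<in> Q" "{x, y} \<in> E"
      by (auto simp: left_ends_def)
    then have c: "x \<in> V" "y \<in> V" "x \<noteq> y" "{x, y} \<notin> nsets R 2"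
      by (auto simp: E_def nsets_def)
    have "f y < n" using f c by (auto simp: bij_betw_def)
    then have "x \<notin> R"
      using mono[of x y] c y by (auto simp: R_def nsets_def)
    with c y show "x \<in> \<Union>Q \<inter> (V - R)" by blast
  qed
  have right_notL: "right_ends r (Q \<inter> E) \<subseteq> \<Union>Q \<inter> (V - L)" for Q
  proof
    fix y assume "y \<in> right_ends r (Q \<inter> E)"
    then obtain x where x: "(x, y) \<in> r" "{x, y} \<in> Q" "{x, y} \<in> E"
      by (auto simp: right_ends_def)
    then have c: "x \<in> V" "y \<in> V" "x \<noteq> y" "{x, y} \<notin> nsets L 2"
      by (auto simp: E_def nsets_def)
    then have "y \<notin> L"
      using mono[of x y] x by (auto simp: L_def nsets_def)
    with c x show "y \<in> \<Union>Q \<inter> (V - L)" by blast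
  qed
  have one: "card (Q \<inter> E) \<le> card (\<Union>Q \<inter> (V - R)) + card (\<Union>Q \<inter> (V - L))"
    if "Q \<in> \<Q>" for Q
  proof -
    have "queue r (Q \<inter> E)"
      using que[OF that] by (auto simp: queue_def intro: pairwise_subset)
    then have "card (Q \<inter> E) \<le> card (left_ends r (Q \<inter> E)) + card (right_ends r (Q \<inter> E))"
      using lin fin by (intro card_queue_le_endpoints[of V]) (auto simp: E_def)
    also have "\<dots> \<le> card (\<Union>Q \<inter> (V - R)) + card (\<Union>Q \<inter> (V - L))"
      using fin by (intro add_mono card_mono left_notR right_notL) auto
    finally show ?thesis .
  qed
  have "E = (\<Union>Q\<in>\<Q>. Q \<inter> E)" using part_union by (auto simp: E_def)
  then have "card E \<le> (\<Sum>Q\<in>\<Q>. card (Q \<inter> E))"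
    using card_UN_le[OF finQ, of "\<lambda>Q. Q \<inter> E"] by simp
  also have "\<dots> \<le> (\<Sum>Q\<in>\<Q>. card (\<Union>Q \<inter> (V - R))) + (\<Sum>Q\<in>\<Q>. card (\<Union>Q \<inter> (V - L)))"
    using one by (simp add: sum_mono flip: sum.distrib)
  also have "\<dots> \<le> k * card (V - R) + k * card (V - L)"
    by (intro add_mono k_local_incidences_le[OF fin finQ loc]) auto
  also have "\<dots> = 2 * k * (card V - a)"
    using cL cR LV RV finLR by (simp add: card_Diff_subset)
  finally show ?thesis using edges by linarith
qed

section \<open>Optimising the number of trimmed vertices\<close>

text \<open>For \<open>\<alpha> = 1 - 1 / sqrt 2\<close> and \<open>c = (9 - 4 sqrt 2) / 16\<close>, the bound on \<open>k\<close> follows once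
  \<open>n (n - 1) / 2 - a (a - 1) - 2 (n - a) (\<alpha> n - c)\<close> is positive. As a function of \<open>a\<close> this is
  a downward parabola with apex at \<open>t = \<alpha> n + 1/2 - c\<close>; the quadratic terms in \<open>n\<close> cancel at the
  apex because \<open>2 \<alpha>\<^sup>2 - 4 \<alpha> + 1 = 0\<close>, leaving the value \<open>sqrt 2 n / 16 + (1/2 - c)\<^sup>2\<close>. Rounding
  \<open>t\<close> to the nearest integer costs at most \<open>1/4\<close>, which is less than that value from \<open>n = 2\<close>
  on.\<close>

lemma threshold_from_trimming:
  fixes k n :: nat
  assumes n: "2 \<le> n"
    and bound: "\<And>a. 2 * a \<le> n \<Longrightarrow> n choose 2 \<le> 2 * k * (n - a) + 2 * (a choose 2)"
  shows "real k > (1 - 1 / sqrt 2) * real n - 1 / 16 * (9 - 4 * sqrt 2)"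
proof -
  define s where "s = sqrt 2"
  have s2: "s * s = 2" by (simp add: s_def)
  have s_lo: "7 / 5 < s" unfolding s_def by (rule real_less_rsqrt) (simp add: power2_eq_square)
  have s_hi: "s < 71 / 50" unfolding s_def by (rule real_less_lsqrt) (auto simp: power2_eq_square)
  have inv: "1 / sqrt 2 = s / 2" using s2 by (simp add: s_def field_simps)
  define N where "N = real n"
  have N: "2 \<le> N" using n by (simp add: N_def)
  define c where "c = (9 - 4 * s) / 16"
  define t where "t = (1 - s / 2) * N + 1 / 2 - c"
  define a where "a = nat (round t)"
  have tpos: "0 \<le> t"
  proof -
    have "0 \<le> (1 - s / 2) * N" using s_hi N by simp
    moreover have "c \<le> 1 / 2" using s_lo by (simp add: c_def)
    ultimately show ?thesis by (simp add: t_def)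
  qed
  have ra: "real a = of_int (round t)"
  proof -
    have "0 \<le> round t" using round_mono[OF tpos] by simp
    then show ?thesis by (simp add: a_def)
  qed
  have ra_dist: "\<bar>real a - t\<bar> \<le> 1 / 2"
    using of_int_round_abs_le[of t] by (simp add: ra)
  have "t \<le> 3 / 10 * N + 3 / 10"
  proof -
    have "(1 - s / 2) * N \<le> 3 / 10 * N" using s_lo N by (intro mult_right_mono) auto
    moreover have "1 / 2 - c \<le> 3 / 10" using s_hi by (simp add: c_def)
    ultimately show ?thesis unfolding t_def by linarith
  qed
  then have aub: "real a \<le> 3 / 10 * N + 8 / 10" using ra_dist by linarith
  have a2: "2 * a \<le> n"
  proof (cases "4 \<le> n")
    case True
    then have "4 \<le> N" by (simp add: N_def)
    then have "2 * real a \<le> N" using aub by linarith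
    then show ?thesis by (simp add: N_def)
  next
    \<comment> \<open>For \<open>n = 2\<close> and \<open>n = 3\<close> the real estimate is too weak, but it forces \<open>a \<le> 1\<close>.\<close>
    case False
    then have "N \<le> 3" by (simp add: N_def)
    then have "real a < 2" using aub by linarith
    then have "a \<le> 1" by simp
    with n show ?thesis by linarith
  qed
  have choose_real: "real (m choose 2) = real m * (real m - 1) / 2" for m
    by (simp add: binomial_gbinomial gbinomial_prod_rev numeral_2_eq_2)
  have "real (n choose 2) \<le> real (2 * k * (n - a) + 2 * (a choose 2))"
    using bound[OF a2] by (rule of_nat_mono)
  moreover have "a \<le> n" using a2 by simp
  ultimately have count: "N * (N - 1) / 2 - real a * (real a - 1) \<le> 2 * real k * (N - real a)"
    by (simp add: choose_real of_nat_diff N_def)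
  \<comment> \<open>Completing the square in \<open>a\<close>; the two sides differ by a multiple of \<open>s\<^sup>2 - 2\<close>.\<close>
  have "N * (N - 1) / 2 - real a * (real a - 1) - 2 * (N - real a) * ((1 - s / 2) * N - c)
      - (s * N / 16 + (1 / 2 - c)\<^sup>2 - (real a - t)\<^sup>2) = (N * N - N) / 4 * (s * s - 2)"
    by (simp add: t_def c_def power2_eq_square field_simps)
  then have apex: "N * (N - 1) / 2 - real a * (real a - 1) - 2 * (N - real a) * ((1 - s / 2) * N - c)
      = s * N / 16 + (1 / 2 - c)\<^sup>2 - (real a - t)\<^sup>2"
    by (simp add: s2)
  have sq: "(real a - t)\<^sup>2 \<le> 1 / 4"
    using power_mono[OF ra_dist, of 2] by (simp add: power2_eq_square)
  have "(1 / 2 - c)\<^sup>2 = (16 * (s * s) - 8 * s + 1) / 256"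
    by (simp add: c_def power2_eq_square field_simps)
  then have "(1 / 2 - c)\<^sup>2 = (33 - 8 * s) / 256"
    by (simp add: s2)
  moreover have "1 / 4 < s * N / 16 + (33 - 8 * s) / 256"
  proof -
    have "s * N / 16 = s / 8 + s * (N - 2) / 16" by (simp add: field_simps)
    moreover have "0 \<le> s * (N - 2) / 16" using s_lo N by simp
    moreover have "1 / 4 < s / 8 + (33 - 8 * s) / 256" using s_lo by (simp add: field_simps)
    ultimately show ?thesis by linarith
  qed
  ultimately have "1 / 4 < s * N / 16 + (1 / 2 - c)\<^sup>2" by (simp only:)
  with sq have "(real a - t)\<^sup>2 < s * N / 16 + (1 / 2 - c)\<^sup>2" by (rule le_less_trans)
  then have "2 * (N - real a) * ((1 - s / 2) * N - c) < N * (N - 1) / 2 - real a * (real a - 1)"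
    by (subst diff_gt_0_iff_gt[symmetric], subst apex) (simp only: diff_gt_0_iff_gt)
  also have "\<dots> \<le> 2 * (N - real a) * real k"
    using count by (simp add: mult_ac)
  finally have "2 * (N - real a) * ((1 - s / 2) * N - c) < 2 * (N - real a) * real k" .
  moreover have "0 < 2 * (N - real a)" using a2 n by (simp add: N_def)
  ultimately have "(1 - s / 2) * N - c < real k"
    by (simp only: mult_less_cancel_left_pos)
  then show ?thesis by (simp add: inv N_def c_def s_def)
qed

theorem lemma4:
  fixes V :: "'a set" and n :: nat
  assumes "finite V" and "card V = n" and "n \<noteq> 1"
  shows "real (local_queue_number V (complete_graph_edges V))
           > (1 - 1 / sqrt 2) * real n - 1 / 16 * (9 - 4 * sqrt 2)"
proof (cases "n = 0")
  case True
  have "sqrt 2 < 9 / 4" by (rule real_less_lsqrt) (auto simp: power2_eq_square)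
  then have "(1 - 1 / sqrt 2) * real n - 1 / 16 * (9 - 4 * sqrt 2) < 0"
    using True by simp
  then show ?thesis by (rule less_le_trans) simp
next
  case False
  with assms have "2 \<le> n" by linarith
  obtain r \<Q> where lay: "queue_layout V (nsets V 2) r \<Q>"
    and loc: "k_local (local_queue_number V (nsets V 2)) V \<Q>"
    using local_queue_number_attained[OF assms(1) order_refl] by blast
  show ?thesis
    using \<open>2 \<le> n\<close> k_local_complete_bound[OF assms(1) lay loc] unfolding assms(2)
    by (rule threshold_from_trimming)
qed

end
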